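(* Let $\mathcal{H}$ be a complex Hilbert space and $S,T\in\mathcal{B}(\mathcal{H})$, and suppose that $T$ is a quasi-isometry. Then $S\in\mathcal{D}_T$ if and only if $T$ majorizes $TS$. Moreover, if $r(T)<1$, then $\mathcal{B}_T=\mathcal{B}(\mathcal{H})$. Also, in the case $r(T)\ge1$, $S\in\mathcal{B}_T$ if and only if there exists $M>0$ such that $$\|Sx\|+\|TSx\|\alpha_m\le M\left(\|x\|+\|Tx\|\alpha_m\right),\quad\forall m\in\mathbb{N},\ \forall x\in\mathcal{H},$$ where $\alpha_m=\sum_{n=1}^{\infty}d_m^{2n}$ and $d_m=\frac{1}{1/m+r(T)}$.
   Context: $\mathcal{B}(\mathcal{H})$ is the algebra of all bounded linear operators on $\mathcal{H}$; $r(T)$ is the spectral radius of $T$. $T\in\mathcal{B}(\mathcal{H})$ is a quasi-isometry if $T^*(T^*T)T=T^*T$. For $T,S\in\mathcal{B}(\mathcal{H})$, $T$ majorizes $S$ if there is $M>0$ with $\|Sx\|\le M\|Tx\|$ for all $x\in\mathcal{H}$. The Deddens algebra $\mathcal{D}_T$ is the set of all $S\in\mathcal{B}(\mathcal{H})$ for which there is $M>0$ with $\|T^nSx\|\le M\|T^nx\|$ for all $n\in\mathbb{N}$ and $x\in\mathcal{H}$. For integers $m\ge1$ put $d_m=\frac{1}{1/m+r(T)}$ and $R_m=\left(\sum_{n=0}^{\infty}d_m^{2n}T^{*n}T^n\right)^{1/2}$ (the series converges in norm and $R_m$ is positive and invertible). The spectral radius algebra $\mathcal{B}_T$ is the set of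 all $S\in\mathcal{B}(\mathcal{H})$ with $\sup_{m\in\mathbb{N}}\|R_mSR_m^{-1}\|<\infty$. *)

theory Defs
  imports "HOL-Analysis.Analysis"
begin

text \<open>
  Complex Hilbert spaces as a type class over the real Hilbert spaces of the library.  The
  complex inner product is linear in its first argument; the norm is the one it induces, since
  \<open>norm x = sqrt (x \<bullet> x)\<close> in \<^class>\<open>real_inner\<close> and \<open>x \<bullet> x = Re (cinner x x)\<close>.
\<close>

class complex_hilbert = real_inner + complete_space +
  fixes scaleC :: "complex \<Rightarrow> 'a \<Rightarrow> 'a" (infixr "*\<^sub>C" 75)
    and cinner :: "'a \<Rightarrow> 'a \<Rightarrow> complex"
  assumes scaleR_scaleC: "r *\<^sub>R x = complex_of_real r *\<^sub>C x"
    and scaleC_add_right: "a *\<^sub>C (x + y) = a *\<^sub>C x + a *\<^sub>C y"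
    and scaleC_add_left: "(a + b) *\<^sub>C x = a *\<^sub>C x + b *\<^sub>C x"
    and scaleC_scaleC: "a *\<^sub>C b *\<^sub>C x = (a * b) *\<^sub>C x"
    and cinner_commute: "cinner x y = cnj (cinner y x)"
    and cinner_add_left: "cinner (x + y) z = cinner x z + cinner y z"
    and cinner_scaleC_left: "cinner (a *\<^sub>C x) y = a * cinner x y"
    and inner_eq_Re_cinner: "x \<bullet> y = Re (cinner x y)"

instantiation complex :: complex_hilbert
begin

definition scaleC_complex :: "complex \<Rightarrow> complex \<Rightarrow> complex"
  where "scaleC_complex a x = a * x"

definition cinner_complex :: "complex \<Rightarrow> complex \<Rightarrow> complex"
  where "cinner_complex x y = x * cnj y"

instance
  by standard
    (auto simp: scaleC_complex_def cinner_complex_def scaleR_conv_of_real inner_complex_def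
      algebra_simps)

end

text \<open>
  The algebra of bounded operators on \<open>H\<close>: \<open>'a \<Rightarrow>\<^sub>L 'a\<close> is the Banach space of bounded
  \<^emph>\<open>real\<close>-linear maps with the operator norm, and its complex-linear elements are singled out.
\<close>

definition bounded_ops :: "('a::complex_hilbert \<Rightarrow>\<^sub>L 'a) set"
  where "bounded_ops = {A :: 'a \<Rightarrow>\<^sub>L 'a. \<forall>c x. A (c *\<^sub>C x) = c *\<^sub>C A x}"

definition op_power :: "('a::complex_hilbert \<Rightarrow>\<^sub>L 'a) \<Rightarrow> nat \<Rightarrow> ('a \<Rightarrow>\<^sub>L 'a)"
  where "op_power A n = ((\<lambda>B. A o\<^sub>L B) ^^ n) id_blinfun"

definition scalar_op :: "complex \<Rightarrow> ('a::complex_hilbert \<Rightarrow>\<^sub>L 'a)"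
  where "scalar_op c = Blinfun (\<lambda>x. c *\<^sub>C x)"

text \<open>\<^const>\<open>Blinfun\<close> is only meaningful on bounded linear maps, which \<open>\<lambda>x. c *\<^sub>C x\<close> is.\<close>

lemma norm_scaleC: "norm (c *\<^sub>C x) = cmod c * norm (x::'a::complex_hilbert)"
proof -
  have "cinner x x = cnj (cinner x x)"
    by (rule cinner_commute)
  then have im: "Im (cinner x x) = 0"
    by (metis cnj.simps(2) equal_neg_zero)
  have "cinner x (c *\<^sub>C x) = cnj c * cinner x x"
    by (metis cinner_commute cinner_scaleC_left complex_cnj_mult)
  then have "cinner (c *\<^sub>C x) (c *\<^sub>C x) = complex_of_real ((cmod c)\<^sup>2) * cinner x x"
    by (simp add: cinner_scaleC_left complex_norm_square mult.assoc del: of_real_power)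
  then have "(c *\<^sub>C x) \<bullet> (c *\<^sub>C x) = (cmod c)\<^sup>2 * (x \<bullet> x)"
    using im by (simp add: inner_eq_Re_cinner)
  then show ?thesis
    by (simp add: norm_eq_sqrt_inner real_sqrt_mult)
qed

lemma bounded_linear_scaleC: "bounded_linear (\<lambda>x::'a::complex_hilbert. c *\<^sub>C x)"
  by (rule bounded_linear_intro[where K = "cmod c"])
    (simp_all add: scaleC_add_right scaleR_scaleC scaleC_scaleC mult.commute norm_scaleC)

lemma scalar_op_apply [simp]: "scalar_op c x = c *\<^sub>C x"
  by (simp add: scalar_op_def bounded_linear_Blinfun_apply bounded_linear_scaleC)

definition hadjoint :: "('a::complex_hilbert \<Rightarrow>\<^sub>L 'a) \<Rightarrow> ('a \<Rightarrow>\<^sub>L 'a)"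
  where "hadjoint A = (THE B. B \<in> bounded_ops \<and> (\<forall>x y. cinner (A x) y = cinner x (B y)))"

definition is_op_inverse :: "('a::complex_hilbert \<Rightarrow>\<^sub>L 'a) \<Rightarrow> ('a \<Rightarrow>\<^sub>L 'a) \<Rightarrow> bool"
  where "is_op_inverse A B \<longleftrightarrow>
    B \<in> bounded_ops \<and> A o\<^sub>L B = id_blinfun \<and> B o\<^sub>L A = id_blinfun"

definition op_inverse :: "('a::complex_hilbert \<Rightarrow>\<^sub>L 'a) \<Rightarrow> ('a \<Rightarrow>\<^sub>L 'a)"
  where "op_inverse A = (THE B. is_op_inverse A B)"

definition positive_op :: "('a::complex_hilbert \<Rightarrow>\<^sub>L 'a) \<Rightarrow> bool"
  where "positive_op A \<longleftrightarrow> A \<in> bounded_ops \<and> (\<forall>x. cinner (A x) x \<in> \<real>\<^sub>\<ge>\<^sub>0)"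

definition op_sqrt :: "('a::complex_hilbert \<Rightarrow>\<^sub>L 'a) \<Rightarrow> ('a \<Rightarrow>\<^sub>L 'a)"
  where "op_sqrt A = (THE P. positive_op P \<and> P o\<^sub>L P = A)"

definition op_spectrum :: "('a::complex_hilbert \<Rightarrow>\<^sub>L 'a) \<Rightarrow> complex set"
  where "op_spectrum A = {c. \<not> (\<exists>B. is_op_inverse (A - scalar_op c) B)}"

text \<open>
  The spectrum is bounded, and nonempty unless \<open>H\<close> is the zero space.  Inserting \<open>0\<close> changes
  nothing for a nonzero space and makes the spectral radius \<open>0\<close> on the zero space, where
  \<^const>\<open>Sup\<close> of the empty set of reals would be unspecified.
\<close>

definition spectral_radius :: "('a::complex_hilbert \<Rightarrow>\<^sub>L 'a) \<Rightarrow> real"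
  where "spectral_radius A = Sup (insert 0 (cmod ` op_spectrum A))"

definition quasi_isometry :: "('a::complex_hilbert \<Rightarrow>\<^sub>L 'a) \<Rightarrow> bool"
  where "quasi_isometry T \<longleftrightarrow>
    hadjoint T o\<^sub>L (hadjoint T o\<^sub>L T) o\<^sub>L T = hadjoint T o\<^sub>L T"

definition majorizes :: "('a::complex_hilbert \<Rightarrow>\<^sub>L 'a) \<Rightarrow> ('a \<Rightarrow>\<^sub>L 'a) \<Rightarrow> bool"
  where "majorizes T S \<longleftrightarrow> (\<exists>M>0. \<forall>x. norm (S x) \<le> M * norm (T x))"

definition deddens_algebra :: "('a::complex_hilbert \<Rightarrow>\<^sub>L 'a) \<Rightarrow> ('a \<Rightarrow>\<^sub>L 'a) set"
  where "deddens_algebra T = {S \<in> bounded_ops.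
    \<exists>M>0. \<forall>n x. norm (op_power T n (S x)) \<le> M * norm (op_power T n x)}"

definition dseq :: "('a::complex_hilbert \<Rightarrow>\<^sub>L 'a) \<Rightarrow> nat \<Rightarrow> real"
  where "dseq T m = 1 / (1 / real m + spectral_radius T)"

text \<open>The series is taken in the operator norm.\<close>

definition Rseq :: "('a::complex_hilbert \<Rightarrow>\<^sub>L 'a) \<Rightarrow> nat \<Rightarrow> ('a \<Rightarrow>\<^sub>L 'a)"
  where "Rseq T m = op_sqrt
    (\<Sum>n. dseq T m ^ (2 * n) *\<^sub>R (op_power (hadjoint T) n o\<^sub>L op_power T n))"

definition spectral_radius_algebra :: "('a::complex_hilbert \<Rightarrow>\<^sub>L 'a) \<Rightarrow> ('a \<Rightarrow>\<^sub>L 'a) set"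
  where "spectral_radius_algebra T = {S \<in> bounded_ops.
    bdd_above ((\<lambda>m. norm (Rseq T m o\<^sub>L S o\<^sub>L op_inverse (Rseq T m))) ` {1..})}"

text \<open>The sum over \<open>n \<ge> 1\<close>, re-indexed to start at \<open>0\<close>.\<close>

definition alpha_seq :: "('a::complex_hilbert \<Rightarrow>\<^sub>L 'a) \<Rightarrow> nat \<Rightarrow> real"
  where "alpha_seq T m = (\<Sum>n. dseq T m ^ (2 * Suc n))"

end

theory Submission
  imports Defs
begin

text \<open>
  For a quasi-isometry \<open>norm (T\<^sup>n x) = norm (T x)\<close> and \<open>T\<^sup>*\<^sup>n T\<^sup>n = T\<^sup>* T\<close> for \<open>n \<ge> 1\<close>. The first identity
  gives the description of the Deddens algebra. By the second, when \<open>r(T) \<ge> 1\<close>, the operator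
  \<open>R\<^sub>m\<close> is the square root of \<open>I + \<alpha>\<^sub>m T\<^sup>* T\<close>, so \<open>norm (R\<^sub>m x)\<^sup>2 = norm x\<^sup>2 + \<alpha>\<^sub>m norm (T x)\<^sup>2\<close>;
  membership in the spectral radius algebra means \<open>norm (R\<^sub>m S x) \<le> M * norm (R\<^sub>m x)\<close> uniformly
  in \<open>m\<close>, and the weight \<open>sqrt \<alpha>\<^sub>m\<close> this produces may be traded for \<open>\<alpha>\<^sub>m\<close> by changing the index.
  When \<open>r(T) < 1\<close>, the constancy of \<open>norm (T\<^sup>n x)\<close> forces \<open>T = 0\<close> and every \<open>R\<^sub>m\<close> is the identity.
\<close>

\<comment> \<open>With this the operator space is complete in the operator norm, as the fixed point
  argument for square roots requires.\<close>
subclass (in complex_hilbert) banach ..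

section \<open>Adjoints\<close>

lemma inner_scaleC_left:
  fixes x y :: "'a::complex_hilbert"
  shows "(c *\<^sub>C x) \<bullet> y = x \<bullet> (cnj c *\<^sub>C y)"
proof -
  have "cinner x (cnj c *\<^sub>C y) = c * cinner x y"
    by (metis cinner_commute cinner_scaleC_left complex_cnj_cnj complex_cnj_mult)
  then show ?thesis
    by (simp add: inner_eq_Re_cinner cinner_scaleC_left)
qed

lemma Im_cinner:
  fixes x y :: "'a::complex_hilbert"
  shows "Im (cinner x y) = - ((\<i> *\<^sub>C x) \<bullet> y)"
  by (simp add: inner_eq_Re_cinner cinner_scaleC_left)

text \<open>The representing vector minimises \<open>F\<close>: the parallelogram law makes a
  minimising sequence Cauchy, and varying its limit in the direction \<open>h\<close> gives the
  identity.\<close>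

lemma riesz_representation:
  fixes f :: "'a::{real_inner, complete_space} \<Rightarrow> real"
  assumes "bounded_linear f"
  obtains a where "\<And>x. f x = x \<bullet> a"
proof -
  interpret f: bounded_linear f by fact
  define F where "F x = (norm x)\<^sup>2 - 2 * f x" for x
  define d where "d = Inf (range F)"
  obtain K where K: "\<And>x. norm (f x) \<le> norm x * K"
    using f.bounded by blast
  have "- K\<^sup>2 \<le> F x" for x
  proof -
    have "f x \<le> norm x * K"
      using K[of x] by simp
    moreover have "0 \<le> (norm x - K)\<^sup>2"
      by simp
    ultimately show ?thesis
      by (simp add: F_def power2_diff)
  qed
  then have bdd: "bdd_below (range F)"
    by (auto intro!: bdd_belowI)
  then have d_le: "d \<le> F x" for x
    unfolding d_def by (simp add: cInf_lower)
  have "\<exists>x. F x < d + 1 / Suc n" for n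
    using cInf_less_iff[OF _ bdd, of "d + 1 / Suc n"] unfolding d_def by auto
  then obtain X where X: "\<And>n. F (X n) < d + 1 / Suc n"
    by metis
  have para: "(norm (x - y))\<^sup>2 \<le> 2 * (F x - d) + 2 * (F y - d)" for x y
  proof -
    have "(norm (x - y))\<^sup>2 = 2 * F x + 2 * F y - 4 * F ((1/2) *\<^sub>R (x + y))"
      by (simp add: F_def f.scaleR f.add power2_norm_eq_inner inner_add inner_diff
          inner_commute algebra_simps)
    then show ?thesis
      using d_le[of "(1/2) *\<^sub>R (x + y)"] by simp
  qed
  have "Cauchy X"
  proof (rule metric_CauchyI)
    fix e :: real
    assume "0 < e"
    then obtain N where N: "1 / Suc N < e\<^sup>2 / 4"
      using reals_Archimedean[of "e\<^sup>2 / 4"] by (auto simp: inverse_eq_divide)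
    have small: "F (X n) - d < e\<^sup>2 / 4" if "N \<le> n" for n
    proof -
      have "1 / real (Suc n) \<le> 1 / real (Suc N)"
        using that by (simp add: frac_le)
      then show ?thesis
        using X[of n] N by linarith
    qed
    show "\<exists>M. \<forall>m\<ge>M. \<forall>n\<ge>M. dist (X m) (X n) < e"
    proof (intro exI allI impI)
      fix m n
      assume "N \<le> m" "N \<le> n"
      then have "(norm (X m - X n))\<^sup>2 < e\<^sup>2"
        using para[of "X m" "X n"] small[of m] small[of n] by simp
      then show "dist (X m) (X n) < e"
        using \<open>0 < e\<close> by (simp add: dist_norm power2_less_imp_less)
    qed
  qed
  then obtain a where a: "X \<longlonglongrightarrow> a"
    using Cauchy_convergent convergent_def by blast
  have "(\<lambda>n. F (X n)) \<longlonglongrightarrow> F a"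
    unfolding F_def by (intro tendsto_intros a f.tendsto)
  moreover have "(\<lambda>n. d + 1 / real (Suc n)) \<longlonglongrightarrow> d + 0"
    by (intro tendsto_intros LIMSEQ_Suc[OF lim_1_over_n])
  ultimately have "F a \<le> d + 0"
    by (rule LIMSEQ_le) (intro exI allI impI less_imp_le X)
  then have Fa: "F a \<le> F x" for x
    using d_le[of x] by simp
  have "f h = h \<bullet> a" for h
  proof -
    define e where "e = f h - h \<bullet> a"
    \<comment> \<open>The optimal step along \<open>h\<close> is
      \<open>e / (norm h)\<^sup>2\<close>; the added 1 keeps the denominator positive at
      \<open>h = 0\<close>, and the step still takes \<open>F\<close> below its minimum unless
      \<open>e = 0\<close>.\<close>
    define t where "t = e / ((norm h)\<^sup>2 + 1)"
    have pos: "(norm h)\<^sup>2 + 1 > 0"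
      by (simp add: add_nonneg_pos)
    have te: "t * ((norm h)\<^sup>2 + 1) = e"
      using pos by (simp add: t_def)
    have "F (a + t *\<^sub>R h) - F a = t\<^sup>2 * (norm h)\<^sup>2 - 2 * t * e"
      unfolding F_def power2_norm_eq_inner
      by (simp add: e_def f.scaleR f.add inner_add inner_commute algebra_simps power2_eq_square)
    also have "\<dots> = - (t\<^sup>2 * ((norm h)\<^sup>2 + 2))"
      unfolding te[symmetric] by (simp add: algebra_simps power2_eq_square)
    finally have "t\<^sup>2 * ((norm h)\<^sup>2 + 2) \<le> 0"
      using Fa[of "a + t *\<^sub>R h"] by simp
    moreover have "(norm h)\<^sup>2 + 2 > 0"
      by (simp add: add_nonneg_pos)
    ultimately have "t = 0"
      by (simp add: mult_le_0_iff)
    then show ?thesis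
      using te by (simp add: e_def)
  qed
  then show thesis
    using that by blast
qed

text \<open>Riesz is applied to the real part of the form. Complex linearity of \<open>A\<close>
  passes to the map so found, and evaluation at i times \<open>x\<close> recovers the imaginary
  part.\<close>

lemma ex_adjoint:
  fixes A :: "'a::complex_hilbert \<Rightarrow>\<^sub>L 'a"
  assumes "A \<in> bounded_ops"
  shows "\<exists>B. B \<in> bounded_ops \<and> (\<forall>x y. cinner (A x) y = cinner x (B y))"
proof -
  have "\<exists>a. \<forall>x. A x \<bullet> y = x \<bullet> a" for y
    using riesz_representation[of "\<lambda>x. A x \<bullet> y"]
    by (metis blinfun.bounded_linear_right bounded_linear_inner_left_comp)
  then obtain g where g: "\<And>x y. A x \<bullet> y = x \<bullet> g y"
    by metis
  have eqI: "u = v" if "\<And>x. x \<bullet> u = x \<bullet> v" for u v :: 'a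
    using that vector_eq_ldot by blast
  have C: "A (c *\<^sub>C x) = c *\<^sub>C A x" for c x
    using assms by (simp add: bounded_ops_def)
  have gC: "g (c *\<^sub>C y) = c *\<^sub>C g y" for c y
  proof (rule eqI)
    fix x
    have "x \<bullet> g (c *\<^sub>C y) = A (cnj c *\<^sub>C x) \<bullet> y"
      by (simp add: g[symmetric] inner_scaleC_left C)
    then show "x \<bullet> g (c *\<^sub>C y) = x \<bullet> (c *\<^sub>C g y)"
      by (simp add: g inner_scaleC_left)
  qed
  have "bounded_linear g"
  proof (rule bounded_linear_intro)
    show "g (x + y) = g x + g y" for x y
      by (rule eqI) (simp add: g[symmetric] inner_add)
    show "g (r *\<^sub>R x) = r *\<^sub>R g x" for r x
      by (rule eqI) (simp add: g[symmetric])
    show "norm (g y) \<le> norm y * norm A" for y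
    proof (cases "g y = 0")
      case False
      have "norm (g y) * norm (g y) = A (g y) \<bullet> y"
        by (simp add: g dot_square_norm power2_eq_square)
      also have "\<dots> \<le> norm (A (g y)) * norm y"
        by (rule norm_cauchy_schwarz)
      also have "\<dots> \<le> norm A * norm (g y) * norm y"
        by (intro mult_right_mono norm_blinfun) simp
      finally show ?thesis
        using False by (simp add: mult.commute mult.left_commute)
    qed simp
  qed
  then have B: "blinfun_apply (Blinfun g) = g"
    by (rule bounded_linear_Blinfun_apply)
  have "cinner (A x) y = cinner x (g y)" for x y
    by (rule complex_eqI)
      (simp_all add: inner_eq_Re_cinner[symmetric] g Im_cinner C[symmetric])
  then show ?thesis
    using B gC by (intro exI[of _ "Blinfun g"]) (simp add: bounded_ops_def)
qed

text \<open>This justifies the \<open>THE\<close> in \<open>hadjoint\<close>; uniqueness holds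
  because real inner products already separate points.\<close>

lemma
  fixes A :: "'a::complex_hilbert \<Rightarrow>\<^sub>L 'a"
  assumes "A \<in> bounded_ops"
  shows hadjoint_bounded_ops: "hadjoint A \<in> bounded_ops"
    and inner_hadjoint: "A x \<bullet> y = x \<bullet> hadjoint A y"
proof -
  have "\<exists>!B. B \<in> bounded_ops \<and> (\<forall>x y. cinner (A x) y = cinner x (B y))"
  proof (rule ex_ex1I[OF ex_adjoint[OF assms]])
    fix B B'
    assume "B \<in> bounded_ops \<and> (\<forall>x y. cinner (A x) y = cinner x (B y))"
      and "B' \<in> bounded_ops \<and> (\<forall>x y. cinner (A x) y = cinner x (B' y))"
    then have "x \<bullet> B y = x \<bullet> B' y" for x y
      by (metis inner_eq_Re_cinner)
    then show "B = B'"
      by (metis blinfun_eqI vector_eq_ldot)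
  qed
  from theI'[OF this, folded hadjoint_def]
  show "hadjoint A \<in> bounded_ops" "A x \<bullet> y = x \<bullet> hadjoint A y"
    by (auto simp: inner_eq_Re_cinner)
qed

section \<open>Invertible operators\<close>

lemma bounded_ops_id [simp]: "id_blinfun \<in> bounded_ops"
  and bounded_ops_scalar [simp]: "scalar_op c \<in> bounded_ops"
  by (simp_all add: bounded_ops_def scaleC_scaleC mult.commute)

lemma scaleC_zero_left: "0 *\<^sub>C (x::'a::complex_hilbert) = 0"
  using scaleR_scaleC[of 0 x] by simp

lemma scaleC_scaleR:
  fixes x :: "'a::complex_hilbert"
  shows "c *\<^sub>C r *\<^sub>R x = r *\<^sub>R c *\<^sub>C x"
  by (simp add: scaleR_scaleC scaleC_scaleC mult.commute)

lemma scaleC_zero_right: "c *\<^sub>C (0::'a::complex_hilbert) = 0"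
  by (rule linear_0[OF bounded_linear.linear[OF bounded_linear_scaleC]])

lemma scaleC_diff_right:
  fixes x y :: "'a::complex_hilbert"
  shows "c *\<^sub>C (x - y) = c *\<^sub>C x - c *\<^sub>C y"
  by (rule linear_diff[OF bounded_linear.linear[OF bounded_linear_scaleC]])

lemma
  assumes "A \<in> bounded_ops" "B \<in> bounded_ops"
  shows bounded_ops_add: "A + B \<in> bounded_ops"
    and bounded_ops_diff: "A - B \<in> bounded_ops"
    and bounded_ops_compose: "A o\<^sub>L B \<in> bounded_ops"
  using assms by (simp_all add: bounded_ops_def blinfun.bilinear_simps scaleC_add_right scaleC_diff_right)

lemma bounded_ops_scaleR: "A \<in> bounded_ops \<Longrightarrow> r *\<^sub>R A \<in> bounded_ops"
  by (simp add: bounded_ops_def blinfun.bilinear_simps scaleC_scaleR)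

lemma
  assumes "is_op_inverse A B"
  shows is_op_inverse_left: "B (A x) = x"
    and is_op_inverse_right: "A (B x) = x"
  using assms unfolding is_op_inverse_def
  by (metis blinfun_apply_blinfun_compose id_blinfun.rep_eq)+

lemma is_op_inverse_unique:
  assumes "is_op_inverse A B" "is_op_inverse A B'"
  shows "B = B'"
  using is_op_inverse_left[OF assms(1)] is_op_inverse_right[OF assms(2)]
  by (metis blinfun_eqI)

lemma op_inverse_works:
  assumes "is_op_inverse A B"
  shows "is_op_inverse A (op_inverse A)"
  unfolding op_inverse_def
  by (rule theI) (use assms is_op_inverse_unique in blast)+

text \<open>For \<open>norm (A - c) < \<bar>c\<bar>\<close>, solving \<open>A x = y\<close> is a fixed point problem
  for the contraction \<open>x \<mapsto> (y - (A - c) x) / c\<close>.\<close>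

lemma near_scalar_invertible:
  fixes A :: "'a::complex_hilbert \<Rightarrow>\<^sub>L 'a"
  assumes A: "A \<in> bounded_ops" and less: "norm (A - scalar_op c) < cmod c"
  obtains B where "is_op_inverse A B"
proof -
  define E where "E = A - scalar_op c"
  have c: "c \<noteq> 0"
    using less norm_ge_zero[of "A - scalar_op c"] by auto
  have AE: "A x = E x + c *\<^sub>C x" for x
    by (simp add: E_def blinfun.diff_left)
  define k where "k = norm E / cmod c"
  have k: "0 \<le> k" "k < 1"
    using less c by (simp_all add: k_def E_def)
  have E_le: "norm (inverse c *\<^sub>C E x) \<le> k * norm x" for x
  proof -
    have "norm (inverse c *\<^sub>C E x) = norm (E x) / cmod c"
      by (simp add: norm_scaleC norm_inverse divide_inverse mult.commute)
    also have "\<dots> \<le> norm E * norm x / cmod c"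
      by (intro divide_right_mono norm_blinfun) simp
    finally show ?thesis
      by (simp add: k_def)
  qed
  have inv: "c *\<^sub>C inverse c *\<^sub>C x = x" "inverse c *\<^sub>C c *\<^sub>C x = x" for x :: 'a
    using c scaleR_scaleC[of 1 x] by (simp_all add: scaleC_scaleC)
  \<comment> \<open>This bound is used twice: it makes solutions unique, so that the pointwise
    solution \<open>g\<close> is linear, and it bounds the norm of \<open>g\<close>.\<close>
  have lower: "norm x * ((1 - k) * cmod c) \<le> norm (A x)" for x
  proof -
    have "inverse c *\<^sub>C A x - inverse c *\<^sub>C E x = x"
      by (simp add: AE scaleC_add_right inv)
    then have "norm x \<le> norm (inverse c *\<^sub>C A x) + k * norm x"
      using norm_triangle_ineq4[of "inverse c *\<^sub>C A x" "inverse c *\<^sub>C E x"] E_le[of x] by simp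
    then have "norm x * (1 - k) \<le> norm (A x) / cmod c"
      by (simp add: norm_scaleC norm_inverse divide_inverse algebra_simps)
    then show ?thesis
      using c by (simp add: field_simps)
  qed
  have "\<exists>x. A x = y" for y
  proof -
    have "\<exists>!x. inverse c *\<^sub>C (y - E x) = x"
    proof (rule banach_fix_type[OF k])
      show "\<forall>u v. dist (inverse c *\<^sub>C (y - E u)) (inverse c *\<^sub>C (y - E v)) \<le> k * dist u v"
      proof (intro allI)
        fix u v
        have "inverse c *\<^sub>C (y - E u) - inverse c *\<^sub>C (y - E v) = inverse c *\<^sub>C E (v - u)"
          by (simp add: scaleC_diff_right blinfun.diff_right)
        then show "dist (inverse c *\<^sub>C (y - E u)) (inverse c *\<^sub>C (y - E v)) \<le> k * dist u v"
          using E_le[of "v - u"] by (simp add: dist_norm norm_minus_commute)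
      qed
    qed
    then obtain x where "inverse c *\<^sub>C (y - E x) = x"
      by blast
    then have "c *\<^sub>C x = y - E x"
      using inv(1)[of "y - E x"] by simp
    then show ?thesis
      by (intro exI[of _ x]) (simp add: AE)
  qed
  then obtain g where g: "\<And>y. A (g y) = y"
    by metis
  have q: "0 < (1 - k) * cmod c"
    using k c by simp
  have inj: "x = y" if "A x = A y" for x y
    using mult_right_le_imp_le[OF _ q, of "norm (x - y)" 0] lower[of "x - y"] that
    by (simp add: blinfun.diff_right)
  have A_C: "A (d *\<^sub>C x) = d *\<^sub>C A x" for d x
    using A by (simp add: bounded_ops_def)
  have "bounded_linear g"
  proof (rule bounded_linear_intro)
    show "g (x + y) = g x + g y" for x y
      by (rule inj) (simp add: g blinfun.add_right)
    show "g (r *\<^sub>R x) = r *\<^sub>R g x" for r x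
      by (rule inj) (simp add: g blinfun.scaleR_right)
    show "norm (g y) \<le> norm y * (1 / ((1 - k) * cmod c))" for y
      using lower[of "g y"] q by (simp add: g pos_le_divide_eq)
  qed
  then have B: "blinfun_apply (Blinfun g) = g"
    by (rule bounded_linear_Blinfun_apply)
  have "g (d *\<^sub>C y) = d *\<^sub>C g y" for d y
    by (rule inj) (simp add: g A_C)
  moreover have "g (A x) = x" for x
    by (rule inj) (simp add: g)
  ultimately have "is_op_inverse A (Blinfun g)"
    by (auto simp: is_op_inverse_def bounded_ops_def B g intro!: blinfun_eqI)
  then show thesis
    using that by blast
qed

lemma is_op_inverse_lower_bound:
  assumes "is_op_inverse A B"
  shows "norm x \<le> norm B * norm (A x)"
proof -
  have "norm (B (A x)) \<le> norm B * norm (A x)"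
    by (rule norm_blinfun)
  then show ?thesis
    by (simp add: is_op_inverse_left[OF assms])
qed

text \<open>Substituting \<open>R m x\<close> for the argument removes the inverse from the
  estimate; nothing is lost because \<open>R m\<close> is onto.\<close>

lemma bdd_above_similar_iff:
  assumes inv: "\<forall>m\<in>I. \<exists>B. is_op_inverse (R m) B"
  shows "bdd_above ((\<lambda>m. norm (R m o\<^sub>L S o\<^sub>L op_inverse (R m))) ` I) \<longleftrightarrow>
    (\<exists>M>0. \<forall>m\<in>I. \<forall>x. norm (R m (S x)) \<le> M * norm (R m x))"
proof -
  define Q where "Q m = op_inverse (R m)" for m
  have Q: "Q m (R m x) = x" "R m (Q m x) = x" if "m \<in> I" for m x
    using bspec[OF inv that] op_inverse_works is_op_inverse_left is_op_inverse_right unfolding Q_def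
    by metis+
  have le_iff: "norm (R m o\<^sub>L S o\<^sub>L Q m) \<le> M \<longleftrightarrow>
      (\<forall>x. norm (R m (S x)) \<le> M * norm (R m x))" if "m \<in> I" "0 \<le> M" for m M
  proof
    assume L: "norm (R m o\<^sub>L S o\<^sub>L Q m) \<le> M"
    show "\<forall>x. norm (R m (S x)) \<le> M * norm (R m x)"
    proof
      fix x
      have "norm (R m (S x)) = norm ((R m o\<^sub>L S o\<^sub>L Q m) (R m x))"
        by (simp add: Q that)
      also have "\<dots> \<le> norm (R m o\<^sub>L S o\<^sub>L Q m) * norm (R m x)"
        by (rule norm_blinfun)
      also have "\<dots> \<le> M * norm (R m x)"
        by (intro mult_right_mono L) simp
      finally show "norm (R m (S x)) \<le> M * norm (R m x)" .
    qed
  next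
    assume "\<forall>x. norm (R m (S x)) \<le> M * norm (R m x)"
    then have "norm (R m (S (Q m x))) \<le> M * norm x" for x
      by (metis Q(2) that(1))
    then show "norm (R m o\<^sub>L S o\<^sub>L Q m) \<le> M"
      using that(2) by (intro norm_blinfun_bound) simp_all
  qed
  show ?thesis
  proof
    assume "bdd_above ((\<lambda>m. norm (R m o\<^sub>L S o\<^sub>L op_inverse (R m))) ` I)"
    then obtain M where "\<And>m. m \<in> I \<Longrightarrow> norm (R m o\<^sub>L S o\<^sub>L Q m) \<le> M"
      by (auto simp: bdd_above_def Q_def)
    \<comment> \<open>A bound from \<open>bdd_above\<close> carries no sign when \<open>I\<close> is
      empty; the maximum with 1 makes it positive.\<close>
    then have "\<And>m. m \<in> I \<Longrightarrow> norm (R m o\<^sub>L S o\<^sub>L Q m) \<le> max 1 M"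
      by (simp add: le_max_iff_disj)
    then show "\<exists>M>0. \<forall>m\<in>I. \<forall>x. norm (R m (S x)) \<le> M * norm (R m x)"
      using le_iff[where M = "max 1 M"] by (intro exI[of _ "max 1 M"]) auto
  next
    assume "\<exists>M>0. \<forall>m\<in>I. \<forall>x. norm (R m (S x)) \<le> M * norm (R m x)"
    then obtain M where "M > 0" "\<And>m. m \<in> I \<Longrightarrow> norm (R m o\<^sub>L S o\<^sub>L Q m) \<le> M"
      using le_iff by (metis less_imp_le)
    then show "bdd_above ((\<lambda>m. norm (R m o\<^sub>L S o\<^sub>L op_inverse (R m))) ` I)"
      by (auto simp: Q_def intro!: bdd_aboveI)
  qed
qed

section \<open>Square roots\<close>

text \<open>Symmetry is assumed only for the real inner product. Moving i through \<open>A\<close>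
  and across the product shows that the imaginary part of the form equals its own negative.\<close>

lemma positive_opI:
  assumes A: "A \<in> bounded_ops" and sa: "\<And>x y. A x \<bullet> y = x \<bullet> A y"
    and nonneg: "\<And>x. 0 \<le> A x \<bullet> x"
  shows "positive_op A"
proof -
  have "Im (cinner (A x) x) = 0" for x
  proof -
    have "(\<i> *\<^sub>C A x) \<bullet> x = A (\<i> *\<^sub>C x) \<bullet> x"
      using A by (simp add: bounded_ops_def)
    also have "\<dots> = x \<bullet> (cnj \<i> *\<^sub>C A x)"
      unfolding sa by (rule inner_scaleC_left)
    also have "\<dots> = - ((\<i> *\<^sub>C A x) \<bullet> x)"
      by (metis Im_cinner cinner_commute complex_cnj_i inner_eq_Re_cinner inner_commute
          cinner_scaleC_left complex_cnj_cnj minus_mult_left uminus_complex.sel(1))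
    finally show ?thesis
      by (simp add: Im_cinner)
  qed
  then show ?thesis
    using A nonneg
    by (simp add: positive_op_def complex_nonneg_Reals_iff inner_eq_Re_cinner[symmetric])
qed

text \<open>With \<open>A\<close> rescaled to \<open>I - C\<close>, \<open>norm C < 1\<close>, the root is \<open>I - Y\<close>
  where \<open>Y = (C + Y\<^sup>2) / 2\<close>. The fixed point is found among the operators that commute with
  everything commuting with \<open>C\<close>; this makes it commute with any other square root of \<open>A\<close>.\<close>

lemma op_sqrt_coercive:
  fixes A :: "'a::complex_hilbert \<Rightarrow>\<^sub>L 'a"
  assumes A: "A \<in> bounded_ops" and sa: "\<And>x y. A x \<bullet> y = x \<bullet> A y"
    and lower: "\<And>x. (norm x)\<^sup>2 \<le> A x \<bullet> x"
  shows "\<exists>B. is_op_inverse (op_sqrt A) B"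
    and "(norm (op_sqrt A x))\<^sup>2 = A x \<bullet> x"
proof -
  \<comment> \<open>As \<open>s\<close> is at least the square of \<open>norm A\<close>, the
    quadratic term of \<open>(norm (C x))\<^sup>2\<close> uses up only half of what the linear term
    gains, leaving the factor \<open>1 - 1 / s\<close>. The added 1 gives \<open>s \<ge> 1\<close>,
    so \<open>q\<close> is real.\<close>
  define s where "s = (norm A)\<^sup>2 + 1"
  define q where "q = sqrt (1 - 1 / s)"
  define C where "C = id_blinfun - (1 / s) *\<^sub>R A"
  have s: "s \<ge> 1"
    by (simp add: s_def)
  then have q: "0 \<le> q" "q < 1" "q\<^sup>2 = 1 - 1 / s"
    by (simp_all add: q_def)
  have C_apply: "C x = x - (1 / s) *\<^sub>R A x" for x
    by (simp add: C_def blinfun.bilinear_simps)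
  have "norm (C x) \<le> q * norm x" for x
  proof (rule power2_le_imp_le)
    have "norm (A x) \<le> norm A * norm x"
      by (rule norm_blinfun)
    then have "(norm (A x))\<^sup>2 \<le> (norm A)\<^sup>2 * (norm x)\<^sup>2"
      by (metis norm_ge_zero power_mono power_mult_distrib)
    also have "\<dots> \<le> s * (norm x)\<^sup>2"
      by (simp add: s_def algebra_simps)
    finally have *: "(norm (A x))\<^sup>2 / s\<^sup>2 \<le> (norm x)\<^sup>2 / s"
      using s by (simp add: field_simps power2_eq_square)
    have "(norm (C x))\<^sup>2 = (norm x)\<^sup>2 - 2 * (A x \<bullet> x) / s + (norm (A x))\<^sup>2 / s\<^sup>2"
      unfolding power2_norm_eq_inner C_apply
      by (simp add: inner_diff inner_commute power2_eq_square algebra_simps)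
    also have "\<dots> \<le> (norm x)\<^sup>2 - 2 * (norm x)\<^sup>2 / s + (norm x)\<^sup>2 / s"
      using lower[of x] s * by (intro add_mono diff_mono divide_right_mono) auto
    also have "\<dots> = (q * norm x)\<^sup>2"
      by (simp add: power_mult_distrib q algebra_simps)
    finally show "(norm (C x))\<^sup>2 \<le> (q * norm x)\<^sup>2" .
  qed (use q in simp)
  then have norm_C: "norm C \<le> q"
    using q by (intro norm_blinfun_bound) auto
  define W where "W = {Y \<in> bounded_ops. norm Y \<le> q \<and> (\<forall>x y. Y x \<bullet> y = x \<bullet> Y y) \<and>
    (\<forall>B::'a \<Rightarrow>\<^sub>L 'a. (\<forall>x. B (C x) = C (B x)) \<longrightarrow> (\<forall>x. B (Y x) = Y (B x)))}"
  define F where "F Y = (1 / 2) *\<^sub>R (C + (Y o\<^sub>L Y))" for Y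
  have F_apply: "F Y x = (1 / 2) *\<^sub>R (C x + Y (Y x))" for Y x
    by (simp add: F_def blinfun.bilinear_simps)
  have "\<exists>!Y\<in>W. F Y = Y"
  proof (rule Banach_fix[OF _ _ q(1,2)])
    \<comment> \<open>Each condition compares continuous functions of \<open>Y\<close>; the premise
      on \<open>B\<close> does not depend on \<open>Y\<close>, so the implication is closed
      too.\<close>
    have "closed W"
      unfolding W_def bounded_ops_def mem_Collect_eq
      by (intro closed_Collect_conj closed_Collect_all closed_Collect_imp closed_Collect_eq
          closed_Collect_le continuous_intros
          bounded_linear.continuous_on[OF bounded_linear_scaleC]) auto
    then show "complete W"
      by (simp add: complete_eq_closed)
    have "0 \<in> W"
      using q by (simp add: W_def bounded_ops_def blinfun.bilinear_simps
          scaleC_zero_right)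
    then show "W \<noteq> {}"
      by blast
    have C_ops: "C \<in> bounded_ops"
      unfolding C_def by (intro bounded_ops_diff bounded_ops_scaleR A bounded_ops_id)
    show "F ` W \<subseteq> W"
    proof
      fix Z
      assume "Z \<in> F ` W"
      then obtain Y where Y: "Y \<in> W" and Z: "Z = F Y"
        by blast
      have "norm (Y o\<^sub>L Y) \<le> q * q"
        using Y by (intro order_trans[OF norm_blinfun_compose] mult_mono) (auto simp: W_def q)
      moreover have "q * q \<le> q"
        using q by (simp add: mult_left_le)
      ultimately have "norm (F Y) \<le> q"
        using norm_triangle_ineq[of C "Y o\<^sub>L Y"] norm_C by (simp add: F_def)
      moreover have "F Y \<in> bounded_ops"
        using Y unfolding F_def W_def
        by (auto intro!: bounded_ops_scaleR bounded_ops_add bounded_ops_compose C_ops)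
      moreover have "F Y x \<bullet> y = x \<bullet> F Y y" for x y
      proof -
        have "Y x \<bullet> y = x \<bullet> Y y" for x y
          using Y unfolding W_def by blast
        then show ?thesis
          by (simp add: F_apply C_apply inner_add inner_diff sa)
      qed
      moreover have "B (F Y x) = F Y (B x)" if B: "\<forall>x. B (C x) = C (B x)" for B :: "'a \<Rightarrow>\<^sub>L 'a" and x
      proof -
        have "B (Y x) = Y (B x)" for x
          using Y B unfolding W_def by blast
        then show ?thesis
          using B by (simp add: F_apply blinfun.bilinear_simps)
      qed
      ultimately show "Z \<in> W"
        by (simp add: W_def Z)
    qed
    show "dist (F Y) (F Z) \<le> q * dist Y Z" if "Y \<in> W" "Z \<in> W" for Y Z
    proof -
      \<comment> \<open>This splitting of a difference of squares needs no commutation; each summand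
        has norm at most \<open>q * norm (Y - Z)\<close>.\<close>
      have "F Y - F Z = (1 / 2) *\<^sub>R ((Y o\<^sub>L (Y - Z)) + ((Y - Z) o\<^sub>L Z))"
        by (rule blinfun_eqI) (simp add: F_apply blinfun.bilinear_simps algebra_simps)
      moreover have "norm ((Y o\<^sub>L (Y - Z)) + ((Y - Z) o\<^sub>L Z)) \<le>
          q * norm (Y - Z) + norm (Y - Z) * q"
        using that by (intro order_trans[OF norm_triangle_ineq] add_mono
            order_trans[OF norm_blinfun_compose] mult_mono) (auto simp: W_def q)
      ultimately show ?thesis
        by (simp add: dist_norm)
    qed
  qed
  then obtain Y where Y: "Y \<in> W" and FY: "F Y = Y"
    by blast
  define P where "P = sqrt s *\<^sub>R (id_blinfun - Y)"
  have P_apply: "P x = sqrt s *\<^sub>R (x - Y x)" for x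
    by (simp add: P_def blinfun.bilinear_simps)
  have P_ops: "P \<in> bounded_ops"
    unfolding P_def using Y by (intro bounded_ops_scaleR bounded_ops_diff) (auto simp: W_def)
  have P_sa: "P x \<bullet> y = x \<bullet> P y" for x y
  proof -
    have "Y x \<bullet> y = x \<bullet> Y y"
      using Y unfolding W_def by blast
    then show ?thesis
      by (simp add: P_apply inner_diff)
  qed
  have PP: "P (P x) = A x" for x
  proof -
    have "2 *\<^sub>R F Y x = C x + Y (Y x)"
      by (simp add: F_apply)
    then have "2 *\<^sub>R Y x = C x + Y (Y x)"
      unfolding FY .
    then have "Y (Y x) = 2 *\<^sub>R Y x - C x"
      by simp
    moreover have "P (P x) = s *\<^sub>R (x - 2 *\<^sub>R Y x + Y (Y x))"
      using s by (simp add: P_apply blinfun.bilinear_simps scaleR_2 algebra_simps)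
    ultimately have "P (P x) = s *\<^sub>R (x - C x)"
      by simp
    then show ?thesis
      using s by (simp add: C_apply)
  qed
  have P_lower: "sqrt s * (1 - q) * (norm x)\<^sup>2 \<le> P x \<bullet> x" for x
  proof -
    have "Y x \<bullet> x \<le> norm (Y x) * norm x"
      by (rule norm_cauchy_schwarz)
    also have "\<dots> \<le> norm Y * norm x * norm x"
      by (intro mult_right_mono norm_blinfun) simp
    also have "\<dots> \<le> q * norm x * norm x"
      using Y by (intro mult_right_mono) (auto simp: W_def)
    finally have "(1 - q) * (norm x)\<^sup>2 \<le> (x - Y x) \<bullet> x"
      by (simp add: inner_diff dot_square_norm algebra_simps power2_eq_square)
    then have "sqrt s * ((1 - q) * (norm x)\<^sup>2) \<le> sqrt s * ((x - Y x) \<bullet> x)"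
      using s by (intro mult_left_mono) auto
    then show ?thesis
      by (simp add: P_apply mult.assoc)
  qed
  have coercive: "0 < sqrt s * (1 - q)"
    using s q by simp
  have P_pos: "positive_op P"
  proof (rule positive_opI[OF P_ops P_sa])
    show "0 \<le> P x \<bullet> x" for x
      using P_lower[of x] coercive by (meson mult_nonneg_nonneg less_imp_le order_trans zero_le_power2)
  qed
  have unique: "Q = P" if Q: "positive_op Q" and QQ: "Q o\<^sub>L Q = A" for Q
  proof (rule blinfun_eqI)
    fix x
    have QQ_apply: "Q (Q x) = A x" for x
      using QQ by (metis blinfun_apply_blinfun_compose)
    \<comment> \<open>\<open>Q\<close> commutes with its square \<open>A\<close>, hence with
      \<open>C\<close>; the commutation clause in \<open>W\<close> then carries this to
      \<open>Y\<close> and to \<open>P\<close>.\<close>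
    have "Q (C x) = C (Q x)" for x
      by (simp add: C_apply blinfun.bilinear_simps QQ_apply[symmetric])
    then have "Q (Y x) = Y (Q x)"
      using Y unfolding W_def by blast
    then have PQ: "Q (P x) = P (Q x)"
      by (simp add: P_apply blinfun.bilinear_simps)
    \<comment> \<open>Commutation gives \<open>(P + Q) (P - Q) = A - A = 0\<close>. Pairing with
      \<open>y\<close> leaves a sum of two nonnegative terms, and coercivity of \<open>P\<close>
      forces \<open>y = 0\<close>.\<close>
    define y where "y = P x - Q x"
    have "P y + Q y = 0"
      by (simp add: y_def blinfun.bilinear_simps PQ PP QQ_apply)
    then have "P y \<bullet> y + Q y \<bullet> y = 0"
      by (metis inner_add_left inner_zero_left)
    moreover have "0 \<le> Q y \<bullet> y"
      using Q by (simp add: positive_op_def complex_nonneg_Reals_iff inner_eq_Re_cinner)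
    ultimately have "sqrt s * (1 - q) * (norm y)\<^sup>2 \<le> 0"
      using P_lower[of y] by simp
    then have "(norm y)\<^sup>2 \<le> 0"
      using mult_left_le_imp_le[OF _ coercive, of "(norm y)\<^sup>2" 0] by simp
    then have "y = 0"
      by simp
    then show "Q x = P x"
      by (simp add: y_def)
  qed
  have sqrt: "op_sqrt A = P"
    unfolding op_sqrt_def
  proof (rule the_equality)
    have "P o\<^sub>L P = A"
      by (rule blinfun_eqI) (simp add: PP)
    then show "positive_op P \<and> P o\<^sub>L P = A"
      using P_pos by blast
  qed (use unique in blast)
  \<comment> \<open>\<open>P\<close> differs from the scalar \<open>sqrt s\<close> by an operator of
    norm \<open>sqrt s * norm Y\<close>, which is below \<open>sqrt s\<close>; so \<open>P\<close>
    is invertible.\<close>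
  have "P - scalar_op (complex_of_real (sqrt s)) = - (sqrt s *\<^sub>R Y)"
    by (rule blinfun_eqI)
      (simp add: P_apply blinfun.bilinear_simps scaleR_scaleC[symmetric] algebra_simps)
  moreover have "norm Y < 1"
    using Y q by (simp add: W_def)
  ultimately have "norm (P - scalar_op (complex_of_real (sqrt s))) < cmod (complex_of_real (sqrt s))"
    using s by simp
  then show "\<exists>B. is_op_inverse (op_sqrt A) B"
    using near_scalar_invertible[OF P_ops] unfolding sqrt by metis
  show "(norm (op_sqrt A x))\<^sup>2 = A x \<bullet> x"
    by (simp add: sqrt power2_norm_eq_inner P_sa PP inner_commute)
qed

section \<open>The spectral radius of a quasi-isometry\<close>

text \<open>For larger \<open>c\<close> the operator \<open>A - c\<close> is close enough to the
  scalar \<open>- c\<close> to be invertible. The bound makes the \<open>Sup\<close> in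
  \<open>spectral_radius\<close> meaningful.\<close>

lemma op_spectrum_norm_bound:
  assumes "A \<in> bounded_ops" "c \<in> op_spectrum A"
  shows "cmod c \<le> norm A"
proof (rule ccontr)
  assume "\<not> cmod c \<le> norm A"
  moreover have "A - scalar_op c - scalar_op (- c) = A"
    by (rule blinfun_eqI)
      (simp add: blinfun.bilinear_simps scaleC_add_left[symmetric]
        scaleC_zero_left diff_diff_eq)
  ultimately have "norm (A - scalar_op c - scalar_op (- c)) < cmod (- c)"
    by (simp only: norm_minus_cancel not_le)
  then obtain B where "is_op_inverse (A - scalar_op c) B"
    using near_scalar_invertible[OF bounded_ops_diff[OF assms(1) bounded_ops_scalar]] by metis
  then show False
    using assms(2) by (auto simp: op_spectrum_def)
qed

lemma spectral_radius_less_invertible: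
  assumes "A \<in> bounded_ops" "spectral_radius A < cmod c"
  shows "\<exists>B. is_op_inverse (A - scalar_op c) B"
proof (rule ccontr)
  assume "\<nexists>B. is_op_inverse (A - scalar_op c) B"
  then have "c \<in> op_spectrum A"
    by (simp add: op_spectrum_def)
  moreover have "bdd_above (insert 0 (cmod ` op_spectrum A))"
    by (rule bdd_aboveI[of _ "norm A"]) (auto simp: op_spectrum_norm_bound[OF assms(1)])
  ultimately have "cmod c \<le> spectral_radius A"
    unfolding spectral_radius_def by (intro cSup_upper) auto
  then show False
    using assms(2) by simp
qed

text \<open>Compactness: without a uniform \<open>K\<close>, the offending scalars accumulate at a
  point \<open>l\<close> of the circle. There \<open>A - l\<close> is invertible, and its lower
  bound survives a small change of \<open>l\<close>.\<close>

lemma lower_bound_on_unit_circle: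
  fixes A :: "'a::complex_hilbert \<Rightarrow>\<^sub>L 'a"
  assumes "A \<in> bounded_ops" "spectral_radius A < 1"
  shows "\<exists>K. \<forall>c x. cmod c = 1 \<longrightarrow> norm x \<le> K * norm (A x - c *\<^sub>C x)"
proof (rule ccontr)
  assume "\<not> ?thesis"
  then have "\<exists>c x. cmod c = 1 \<and> real (Suc n) * norm (A x - c *\<^sub>C x) < norm x" for n
    by (meson not_le)
  then obtain c x where c: "\<And>n. cmod (c n) = 1"
    and x: "\<And>n::nat. real (Suc n) * norm (A (x n) - c n *\<^sub>C x n) < norm (x n)"
    by metis
  have "\<forall>n. c n \<in> sphere 0 1"
    using c by simp
  with compact_sphere[of "0::complex" 1] obtain l r where "l \<in> sphere 0 1"
    and r: "strict_mono r" and lim: "(c \<circ> r) \<longlonglongrightarrow> l"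
    unfolding compact_def by metis
  then obtain B where B: "is_op_inverse (A - scalar_op l) B"
    using spectral_radius_less_invertible[OF assms(1), of l] assms(2) by auto
  \<comment> \<open>\<open>e n\<close> combines the two errors: the assumed smallness of
    \<open>A x - c x\<close> and the distance of \<open>c\<close> from \<open>l\<close>. Once it is
    below 1, a nonzero vector would be shorter than itself.\<close>
  define e where "e n = norm B * (inverse (real (Suc (r n))) + norm ((c \<circ> r) n - l))" for n
  have "(\<lambda>n. inverse (real (Suc (r n)))) \<longlonglongrightarrow> 0"
    using LIMSEQ_subseq_LIMSEQ[OF LIMSEQ_inverse_real_of_nat r] by (simp add: o_def)
  then have "e \<longlonglongrightarrow> norm B * (0 + norm (l - l))"
    unfolding e_def by (intro tendsto_intros lim)
  then have "eventually (\<lambda>n. e n < 1) sequentially"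
    by (intro order_tendstoD) auto
  then obtain n where n: "e n < 1"
    by (auto simp: eventually_sequentially)
  define y where "y = x (r n)"
  define d where "d = c (r n)"
  have y: "real (Suc (r n)) * norm (A y - d *\<^sub>C y) < norm y"
    using x unfolding y_def d_def by blast
  then have pos: "0 < norm y"
    by (meson mult_nonneg_nonneg norm_ge_zero of_nat_0_le_iff order_le_less_trans)
  have "norm y \<le> norm B * norm (A y - l *\<^sub>C y)"
    using is_op_inverse_lower_bound[OF B, of y] by (simp add: blinfun.diff_left)
  also have "A y - l *\<^sub>C y = (A y - d *\<^sub>C y) + (d - l) *\<^sub>C y"
    using scaleC_add_left[of "d - l" l y] by simp
  also have "norm B * norm \<dots> \<le> norm B * (inverse (real (Suc (r n))) * norm y + norm (d - l) * norm y)"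
  proof (intro mult_left_mono order_trans[OF norm_triangle_ineq] add_mono)
    show "norm (A y - d *\<^sub>C y) \<le> inverse (real (Suc (r n))) * norm y"
      using y by (simp add: field_simps del: of_nat_Suc)
  qed (simp_all add: norm_scaleC)
  also have "\<dots> = e n * norm y"
    by (simp add: e_def d_def algebra_simps)
  finally have "norm y \<le> e n * norm y" .
  then show False
    using n pos by simp
qed

section \<open>Orthogonality of the roots of unity and a discrete Parseval identity\<close>

lemma sum_roots_of_unity_orthogonal:
  fixes n m N :: nat
  assumes "n < N" "m < N"
  shows "(\<Sum>k<N. cis (2 * pi * k / N) ^ n * cnj (cis (2 * pi * k / N)) ^ m) =
    (if n = m then of_nat N else 0)"
proof -
  \<comment> \<open>Exchanging base index and exponent turns the summands into powers of
    \<open>w\<close>, so the sum is geometric; for \<open>n, m < N\<close> one has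
    \<open>w = 1\<close> only if \<open>n = m\<close>.\<close>
  define w where "w = cis (2 * pi * n / N) * cnj (cis (2 * pi * m / N))"
  have N: "N > 0"
    using assms by simp
  have swap: "cis (2 * pi * real k / real N) ^ l = cis (2 * pi * real l / real N) ^ k" for k l
    unfolding Complex.DeMoivre by (rule arg_cong[where f = cis]) simp
  have pow: "cis (2 * pi * k / N) ^ n * cnj (cis (2 * pi * k / N)) ^ m = w ^ k" for k :: nat
    by (simp only: w_def power_mult_distrib complex_cnj_power[symmetric] swap[of k n] swap[of k m])
  have one: "cis (2 * pi * real k / real N) ^ N = 1" for k
    using swap[of k N] N by simp
  show ?thesis
  proof (cases "n = m")
    case True
    then have "w = 1"
      by (simp add: w_def cis_cnj cis_mult)
    then show ?thesis
      unfolding pow using True by simp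
  next
    case False
    have "inj_on (\<lambda>k. cis (2 * pi * real k / real N)) {..<N}"
      using Complex.bij_betw_roots_unity[OF N] by (rule bij_betw_imp_inj_on)
    then have "cis (2 * pi * n / N) \<noteq> cis (2 * pi * m / N)"
      using False assms by (auto dest!: inj_onD)
    moreover have "w * cis (2 * pi * m / N) = cis (2 * pi * n / N)"
      by (simp add: w_def cis_cnj cis_mult)
    ultimately have "w \<noteq> 1"
      by auto
    moreover have "w ^ N = 1"
      by (simp only: w_def power_mult_distrib complex_cnj_power[symmetric] one complex_cnj_one mult_1)
    ultimately show ?thesis
      unfolding pow using False one_diff_power_eq[of w N] by simp
  qed
qed

lemma scaleC_sum_right: "c *\<^sub>C (\<Sum>i\<in>I. f i :: 'a::complex_hilbert) = (\<Sum>i\<in>I. c *\<^sub>C f i)"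
  by (rule linear_sum[OF bounded_linear.linear[OF bounded_linear_scaleC]])

lemma scaleC_sum_left: "(\<Sum>i\<in>I. f i) *\<^sub>C (x::'a::complex_hilbert) = (\<Sum>i\<in>I. f i *\<^sub>C x)"
  by (induction I rule: infinite_finite_induct) (simp_all add: scaleC_zero_left scaleC_add_left)

text \<open>Expanding the squares leaves only the diagonal, by orthogonality. Uniform bounds at the
  roots of unity thereby bound the sum of the \<open>(norm (y n))\<^sup>2\<close>.\<close>

lemma discrete_parseval:
  fixes y :: "nat \<Rightarrow> 'a::complex_hilbert" and N :: nat
  shows "(\<Sum>k<N. (norm (\<Sum>n<N. cis (2 * pi * k / N) ^ n *\<^sub>C y n))\<^sup>2) = N * (\<Sum>n<N. (norm (y n))\<^sup>2)"
proof -
  define z where "z k = cis (2 * pi * real k / real N)" for k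
  have prod: "(z k ^ n *\<^sub>C y n) \<bullet> (z k ^ m *\<^sub>C y m) =
      ((z k ^ n * cnj (z k) ^ m) *\<^sub>C y n) \<bullet> y m" for k n m
    using inner_scaleC_left[of "cnj (z k) ^ m" "z k ^ n *\<^sub>C y n" "y m"]
    by (simp add: scaleC_scaleC mult.commute)
  have "(\<Sum>k<N. (norm (\<Sum>n<N. z k ^ n *\<^sub>C y n))\<^sup>2) =
      (\<Sum>k<N. \<Sum>n<N. \<Sum>m<N. ((z k ^ n * cnj (z k) ^ m) *\<^sub>C y n) \<bullet> y m)"
    unfolding power2_norm_eq_inner inner_sum_left inner_sum_right prod
    by (intro sum.cong refl sum.swap)
  also have "\<dots> = (\<Sum>n<N. \<Sum>k<N. \<Sum>m<N. ((z k ^ n * cnj (z k) ^ m) *\<^sub>C y n) \<bullet> y m)"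
    by (rule sum.swap)
  also have "\<dots> = (\<Sum>n<N. \<Sum>m<N. \<Sum>k<N. ((z k ^ n * cnj (z k) ^ m) *\<^sub>C y n) \<bullet> y m)"
    by (intro sum.cong refl sum.swap)
  also have "\<dots> = (\<Sum>n<N. \<Sum>m<N. ((\<Sum>k<N. z k ^ n * cnj (z k) ^ m) *\<^sub>C y n) \<bullet> y m)"
    by (simp only: scaleC_sum_left inner_sum_left)
  also have "\<dots> = (\<Sum>n<N. \<Sum>m<N. if n = m then N * (y n \<bullet> y m) else 0)"
  proof (intro sum.cong refl)
    fix n m
    assume "n \<in> {..<N}" "m \<in> {..<N}"
    then have "(\<Sum>k<N. z k ^ n * cnj (z k) ^ m) = (if n = m then of_nat N else 0)"
      unfolding z_def by (intro sum_roots_of_unity_orthogonal) auto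
    then show "((\<Sum>k<N. z k ^ n * cnj (z k) ^ m) *\<^sub>C y n) \<bullet> y m = (if n = m then N * (y n \<bullet> y m) else 0)"
      using scaleR_scaleC[of N "y m", symmetric] by (simp add: scaleC_zero_left)
  qed
  also have "\<dots> = N * (\<Sum>n<N. (norm (y n))\<^sup>2)"
    by (simp add: power2_norm_eq_inner sum_distrib_left)
  finally show ?thesis
    by (simp add: z_def)
qed

section \<open>Powers of a quasi-isometry\<close>

lemma op_power_0 [simp]: "op_power A 0 = id_blinfun"
  and op_power_Suc: "op_power A (Suc n) = A o\<^sub>L op_power A n"
  by (simp_all add: op_power_def)

lemma op_power_Suc2: "op_power A (Suc n) = op_power A n o\<^sub>L A"
proof (induction n)
  case (Suc n)
  then show ?case
    by (intro blinfun_eqI) (metis op_power_Suc blinfun_apply_blinfun_compose)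
qed (auto simp: op_power_Suc intro!: blinfun_eqI)

text \<open>Pairing the defining identity with \<open>x\<close> shows that \<open>T\<close> is
  isometric on its range.\<close>

lemma quasi_isometry_norm:
  assumes "T \<in> bounded_ops" "quasi_isometry T"
  shows "norm (T (T x)) = norm (T x)"
proof -
  have "T (T x) \<bullet> T (T x) = x \<bullet> hadjoint T (hadjoint T (T (T x)))"
    by (simp add: inner_hadjoint[OF assms(1)])
  also have "\<dots> = x \<bullet> hadjoint T (T x)"
    using assms(2) unfolding quasi_isometry_def by (metis blinfun_apply_blinfun_compose)
  also have "\<dots> = T x \<bullet> T x"
    by (simp add: inner_hadjoint[OF assms(1)])
  finally show ?thesis
    by (simp add: norm_eq_sqrt_inner)
qed

lemma quasi_isometry_norm_power:
  assumes "T \<in> bounded_ops" "quasi_isometry T"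
  shows "norm (op_power T (Suc n) x) = norm (T x)"
proof (induction n)
  case (Suc n)
  then show ?case
    by (metis op_power_Suc blinfun_apply_blinfun_compose quasi_isometry_norm[OF assms])
qed (simp add: op_power_Suc)

text \<open>The sums \<open>P z = (\<Sum>n<N. z\<^sup>n T\<^sup>n x)\<close> satisfy \<open>(1 - z T) (P z) = x - z\<^sup>N T\<^sup>N x\<close>, so a spectrum
  off the unit circle bounds them uniformly in \<open>N\<close> and \<open>\<bar>z\<bar> = 1\<close>; but the mean of \<open>norm (P z)\<^sup>2\<close>
  over the \<open>N\<close>-th roots of unity is \<open>norm x\<^sup>2 + (N - 1) norm (T x)\<^sup>2\<close>.\<close>

lemma quasi_isometry_spectral_radius_less_1:
  fixes T :: "'a::complex_hilbert \<Rightarrow>\<^sub>L 'a"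
  assumes T: "T \<in> bounded_ops" "quasi_isometry T" and less: "spectral_radius T < 1"
  shows "T = 0"
proof (rule blinfun_eqI)
  fix x
  obtain K where K: "\<And>c y. cmod c = 1 \<Longrightarrow> norm y \<le> K * norm (T y - c *\<^sub>C y)"
    using lower_bound_on_unit_circle[OF T(1) less] by blast
  \<comment> \<open>The absolute value is taken because \<open>K\<close> comes without a
    sign.\<close>
  define L where "L = \<bar>K\<bar> * (norm x + norm (T x))"
  have bound: "norm (\<Sum>n<Suc N. z ^ n *\<^sub>C op_power T n x) \<le> L" if z: "cmod z = 1" for z N
  proof -
    define f where "f n = z ^ n *\<^sub>C op_power T n x" for n
    define P where "P = (\<Sum>n<Suc N. f n)"
    have zz: "z *\<^sub>C cnj z *\<^sub>C y = y" for y :: 'a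
      using complex_norm_square[of z] scaleR_scaleC[of 1 y] by (simp add: z scaleC_scaleC)
    have "z *\<^sub>C T (f n) = f (Suc n)" for n
      using T(1) by (simp add: f_def bounded_ops_def op_power_Suc scaleC_scaleC)
    then have "z *\<^sub>C T P = (\<Sum>n<Suc N. f (Suc n))"
      by (simp add: P_def blinfun.sum_right scaleC_sum_right del: sum.lessThan_Suc)
    then have "P - z *\<^sub>C T P = (\<Sum>n<Suc N. f n - f (Suc n))"
      by (simp only: P_def sum_subtractf)
    also have "\<dots> = f 0 - f (Suc N)"
      by (rule sum_lessThan_telescope')
    finally have "norm (P - z *\<^sub>C T P) \<le> norm (f 0) + norm (f (Suc N))"
      by (metis norm_triangle_ineq4)
    also have "\<dots> = norm x + norm (T x)"
      by (simp add: f_def norm_scaleC z norm_power quasi_isometry_norm_power[OF T] del: power_Suc)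
    finally have le: "norm (P - z *\<^sub>C T P) \<le> norm x + norm (T x)" .
    \<comment> \<open>On the unit circle \<open>cnj z\<close> inverts \<open>z\<close>, so
      \<open>1 - z T\<close> is \<open>T - cnj z\<close> up to a factor of modulus 1, and
      \<open>K\<close> applies at \<open>cnj z\<close>.\<close>
    have "norm (T P - cnj z *\<^sub>C P) = norm (z *\<^sub>C (T P - cnj z *\<^sub>C P))"
      by (simp add: norm_scaleC z)
    also have "\<dots> = norm (P - z *\<^sub>C T P)"
      by (simp add: scaleC_diff_right zz norm_minus_commute)
    finally have "norm P \<le> K * norm (P - z *\<^sub>C T P)"
      using K[of "cnj z" P] z by simp
    also have "\<dots> \<le> L"
      unfolding L_def by (intro mult_mono le) auto
    finally show ?thesis
      by (simp add: P_def f_def)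
  qed
  have "real N * (norm (T x))\<^sup>2 \<le> L\<^sup>2" for N
  proof -
    let ?z = "\<lambda>k. cis (2 * pi * real k / real (Suc N))"
    have "real (Suc N) * (\<Sum>n<Suc N. (norm (op_power T n x))\<^sup>2) =
        (\<Sum>k<Suc N. (norm (\<Sum>n<Suc N. ?z k ^ n *\<^sub>C op_power T n x))\<^sup>2)"
      by (rule discrete_parseval[symmetric])
    also have "\<dots> \<le> (\<Sum>k<Suc N. L\<^sup>2)"
      by (intro sum_mono power_mono bound) auto
    finally have "(\<Sum>n<Suc N. (norm (op_power T n x))\<^sup>2) \<le> L\<^sup>2"
      by (simp del: sum.lessThan_Suc of_nat_Suc)
    moreover have "(\<Sum>n<Suc N. (norm (op_power T n x))\<^sup>2) = (norm x)\<^sup>2 + real N * (norm (T x))\<^sup>2"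
      by (simp add: sum.lessThan_Suc_shift quasi_isometry_norm_power[OF T] del: sum.lessThan_Suc)
    ultimately show ?thesis
      by (smt (verit) zero_le_power2)
  qed
  then have "\<not> 0 < (norm (T x))\<^sup>2"
    using reals_Archimedean3 not_le by metis
  then show "blinfun_apply T x = blinfun_apply 0 x"
    by simp
qed

section \<open>The operators \<open>R\<^sub>m\<close>\<close>

text \<open>The operator under the root dominates the identity, because the form of
  \<open>hadjoint T o\<^sub>L T\<close> is \<open>(norm (T x))\<^sup>2\<close>; this is the
  coercivity that \<open>op_sqrt_coercive\<close> asks for.\<close>

lemma
  assumes "T \<in> bounded_ops" "0 \<le> a"
  defines "R \<equiv> op_sqrt (id_blinfun + a *\<^sub>R (hadjoint T o\<^sub>L T))"
  shows op_sqrt_invertible: "\<exists>B. is_op_inverse R B"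
    and norm_op_sqrt: "(norm (R x))\<^sup>2 = (norm x)\<^sup>2 + a * (norm (T x))\<^sup>2"
proof -
  let ?A = "id_blinfun + a *\<^sub>R (hadjoint T o\<^sub>L T)"
  have A: "?A x = x + a *\<^sub>R hadjoint T (T x)" for x
    by (simp add: blinfun.bilinear_simps)
  have adj: "hadjoint T x \<bullet> y = x \<bullet> T y" for x y
    using inner_hadjoint[OF assms(1), of y x] by (simp add: inner_commute)
  have ops: "?A \<in> bounded_ops"
    by (intro bounded_ops_add bounded_ops_scaleR bounded_ops_compose hadjoint_bounded_ops
        bounded_ops_id assms)
  have sa: "?A x \<bullet> y = x \<bullet> ?A y" for x y
    unfolding A by (simp add: inner_add adj inner_hadjoint[OF assms(1), symmetric])
  have form: "?A x \<bullet> x = (norm x)\<^sup>2 + a * (norm (T x))\<^sup>2" for x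
    unfolding A by (simp add: inner_add adj dot_square_norm)
  have lower: "(norm x)\<^sup>2 \<le> ?A x \<bullet> x" for x
    unfolding form using assms(2) by simp
  show "\<exists>B. is_op_inverse R B"
    unfolding R_def by (rule op_sqrt_coercive(1)[OF ops sa lower])
  show "(norm (R x))\<^sup>2 = (norm x)\<^sup>2 + a * (norm (T x))\<^sup>2"
    unfolding R_def form[symmetric] by (rule op_sqrt_coercive(2)[OF ops sa lower])
qed

text \<open>The induction peels off the outermost adjoint and the innermost \<open>T\<close>; the
  quasi-isometry identity collapses what remains.\<close>

lemma adjoint_power_compose_power:
  assumes "quasi_isometry T"
  shows "op_power (hadjoint T) (Suc n) o\<^sub>L op_power T (Suc n) = hadjoint T o\<^sub>L T"
proof -
  have q: "hadjoint T (hadjoint T (T (T x))) = hadjoint T (T x)" for x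
    using assms unfolding quasi_isometry_def by (metis blinfun_apply_blinfun_compose)
  have "op_power (hadjoint T) (Suc n) (op_power T (Suc n) x) = hadjoint T (T x)" for x
  proof (induction n arbitrary: x)
    case 0
    show ?case
      by (simp add: op_power_Suc)
  next
    case (Suc n)
    have "op_power (hadjoint T) (Suc (Suc n)) (op_power T (Suc (Suc n)) x) =
        hadjoint T (op_power (hadjoint T) (Suc n) (op_power T (Suc n) (T x)))"
      by (simp only: op_power_Suc[of "hadjoint T" "Suc n"] op_power_Suc2[of T "Suc n"]
          blinfun_apply_blinfun_compose)
    then show ?case
      by (simp only: Suc q)
  qed
  then show ?thesis
    by (intro blinfun_eqI) (simp only: blinfun_apply_blinfun_compose)
qed

text \<open>Convergence is assumed for the operator series, not for the scalar one: this also covers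
  \<open>T = 0\<close>, where the scalar series may diverge and \<open>a = 0\<close> serves.\<close>

lemma Rseq_sums_op_sqrt:
  assumes "quasi_isometry T"
    and "(\<lambda>n. dseq T m ^ (2 * Suc n) *\<^sub>R (hadjoint T o\<^sub>L T)) sums (a *\<^sub>R (hadjoint T o\<^sub>L T))"
  shows "Rseq T m = op_sqrt (id_blinfun + a *\<^sub>R (hadjoint T o\<^sub>L T))"
proof -
  define f where "f n = dseq T m ^ (2 * n) *\<^sub>R (op_power (hadjoint T) n o\<^sub>L op_power T n)" for n
  have "(\<lambda>n. f (Suc n)) sums (a *\<^sub>R (hadjoint T o\<^sub>L T))"
    using assms(2) by (simp only: f_def adjoint_power_compose_power[OF assms(1)])
  then have "f sums (a *\<^sub>R (hadjoint T o\<^sub>L T) + f 0)"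
    by (simp only: sums_Suc_iff)
  moreover have "f 0 = id_blinfun"
    by (simp add: f_def blinfun_eqI)
  ultimately show ?thesis
    by (simp add: Rseq_def sums_unique[symmetric] add.commute flip: f_def)
qed

text \<open>The term \<open>1 / m\<close> makes this strict even at spectral radius 1, so that
  \<open>dseq T m < 1\<close> and the geometric series converges.\<close>

lemma dseq_denominator:
  assumes "1 \<le> spectral_radius T" "1 \<le> m"
  shows "1 < 1 / real m + spectral_radius T"
proof -
  have "0 < 1 / real m"
    using assms(2) by simp
  then show ?thesis
    using assms(1) by linarith
qed

lemma alpha_seq_sums:
  assumes "1 \<le> spectral_radius T" "1 \<le> m"
  shows "(\<lambda>n. dseq T m ^ (2 * Suc n)) sums alpha_seq T m"
    and "alpha_seq T m = 1 / ((1 / m + spectral_radius T)\<^sup>2 - 1)"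
proof -
  define d where "d = dseq T m"
  have d: "0 < d" "d < 1"
    using dseq_denominator[OF assms] by (simp_all add: d_def dseq_def)
  then have "norm (d\<^sup>2) < 1"
    by (simp add: power_less_one_iff)
  then have "(\<lambda>n. d\<^sup>2 * (d\<^sup>2) ^ n) sums (d\<^sup>2 * (1 / (1 - d\<^sup>2)))"
    by (intro sums_mult geometric_sums)
  then have *: "(\<lambda>n. dseq T m ^ (2 * Suc n)) sums (d\<^sup>2 / (1 - d\<^sup>2))"
    by (simp only: d_def power_mult power_Suc times_divide_eq_right mult_1_right)
  then show "(\<lambda>n. dseq T m ^ (2 * Suc n)) sums alpha_seq T m"
    unfolding alpha_seq_def by (metis sums_summable summable_sums)
  have "alpha_seq T m = d\<^sup>2 / (1 - d\<^sup>2)"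
    using * unfolding alpha_seq_def by (rule sums_unique[symmetric])
  also have "\<dots> = 1 / (1 / d\<^sup>2 - 1)"
    using d by (simp add: field_simps)
  also have "1 / d\<^sup>2 = (1 / m + spectral_radius T)\<^sup>2"
    by (simp add: d_def dseq_def power_divide)
  finally show "alpha_seq T m = 1 / ((1 / m + spectral_radius T)\<^sup>2 - 1)" .
qed

lemma alpha_seq_pos:
  assumes "1 \<le> spectral_radius T" "1 \<le> m"
  shows "0 < alpha_seq T m"
proof -
  have "1 < (1 / real m + spectral_radius T)\<^sup>2"
    using dseq_denominator[OF assms] by (rule one_less_power) simp
  then show ?thesis
    by (simp add: alpha_seq_sums[OF assms])
qed

lemma
  assumes "T \<in> bounded_ops" "quasi_isometry T" "1 \<le> spectral_radius T" "1 \<le> m"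
  shows Rseq_invertible: "\<exists>B. is_op_inverse (Rseq T m) B"
    and norm_Rseq: "(norm (Rseq T m x))\<^sup>2 = (norm x)\<^sup>2 + alpha_seq T m * (norm (T x))\<^sup>2"
proof -
  have "Rseq T m = op_sqrt (id_blinfun + alpha_seq T m *\<^sub>R (hadjoint T o\<^sub>L T))"
    by (intro Rseq_sums_op_sqrt assms bounded_linear.sums[OF bounded_linear_scaleR_left]
        alpha_seq_sums)
  then show "\<exists>B. is_op_inverse (Rseq T m) B"
    "(norm (Rseq T m x))\<^sup>2 = (norm x)\<^sup>2 + alpha_seq T m * (norm (T x))\<^sup>2"
    using op_sqrt_invertible[OF assms(1)] norm_op_sqrt[OF assms(1)] alpha_seq_pos[OF assms(3,4)]
    by simp_all
qed

section \<open>Comparing \<open>\<alpha>\<^sub>m\<close> with its square root\<close>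

text \<open>The norm of \<open>R\<^sub>m x\<close> is comparable to \<open>norm x + sqrt \<alpha>\<^sub>m * norm (T x)\<close>, without a square
  in the weight. For \<open>r(T) = 1\<close> one has \<open>\<alpha>\<^sub>m \<approx> m\<close>, so \<open>sqrt \<alpha>\<^sub>k\<close> at \<open>k = m\<^sup>2\<close> replaces \<open>\<alpha>\<^sub>m\<close> and
  \<open>\<alpha>\<^sub>k\<close> at \<open>k \<approx> sqrt m\<close> replaces \<open>sqrt \<alpha>\<^sub>m\<close>; for \<open>r(T) > 1\<close> both weights are bounded and
  bounded away from \<open>0\<close>.\<close>

lemma weighted_bound_reindex:
  fixes a b :: "nat \<Rightarrow> real" and p q u v :: "'x \<Rightarrow> real"
  assumes nonneg: "\<And>x. 0 \<le> p x" "\<And>x. 0 \<le> q x" "\<And>x. 0 \<le> u x" "\<And>x. 0 \<le> v x"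
    and K: "1 \<le> K"
    and comparable: "\<forall>m\<ge>1. \<exists>k\<ge>1. b m \<le> K * a k \<and> a k \<le> K * b m"
    and bound: "\<exists>M>0. \<forall>m\<ge>1. \<forall>x. p x + q x * a m \<le> M * (u x + v x * a m)"
  shows "\<exists>M>0. \<forall>m\<ge>1. \<forall>x. p x + q x * b m \<le> M * (u x + v x * b m)"
proof -
  obtain M where "M > 0" and M: "\<And>m x. 1 \<le> m \<Longrightarrow> p x + q x * a m \<le> M * (u x + v x * a m)"
    using bound by blast
  \<comment> \<open>A change of weight costs a factor \<open>K\<close> on each side of the bound;
    \<open>1 \<le> K\<close> absorbs the unweighted term.\<close>
  have scale: "s + t * d \<le> K * (s + t * c)" if "0 \<le> s" "0 \<le> t" "d \<le> K * c" for s t c d :: real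
  proof -
    have "t * d \<le> t * (K * c)"
      using that by (intro mult_left_mono)
    moreover have "1 * s \<le> K * s"
      using that K by (intro mult_right_mono)
    ultimately show ?thesis
      by (simp add: algebra_simps)
  qed
  have "p x + q x * b m \<le> (K * M * K) * (u x + v x * b m)" if m: "1 \<le> m" for m x
  proof -
    obtain k where k: "1 \<le> k" "b m \<le> K * a k" "a k \<le> K * b m"
      using comparable m by blast
    have "p x + q x * b m \<le> K * (p x + q x * a k)"
      by (intro scale nonneg k)
    also have "\<dots> \<le> K * (M * (u x + v x * a k))"
      using K by (intro mult_left_mono M k) auto
    also have "\<dots> \<le> K * (M * (K * (u x + v x * b m)))"
      using K \<open>M > 0\<close> by (intro mult_left_mono scale nonneg k) auto
    finally show ?thesis
      by (simp add: mult.assoc)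
  qed
  moreover have "K * M * K > 0"
    using K \<open>M > 0\<close> by simp
  ultimately show ?thesis
    by blast
qed

lemma alpha_seq_comparable_sqrt:
  assumes r: "1 \<le> spectral_radius T"
  obtains K where "1 \<le> K"
    and "\<forall>m\<ge>1. \<exists>k\<ge>1. alpha_seq T m \<le> K * sqrt (alpha_seq T k) \<and>
      sqrt (alpha_seq T k) \<le> K * alpha_seq T m"
    and "\<forall>m\<ge>1. \<exists>k\<ge>1. sqrt (alpha_seq T m) \<le> K * alpha_seq T k \<and>
      alpha_seq T k \<le> K * sqrt (alpha_seq T m)"
proof (cases "spectral_radius T = 1")
  case True
  have bounds: "real m \<le> 3 * alpha_seq T m" "alpha_seq T m \<le> real m" if "1 \<le> m" for m
  proof -
    have "alpha_seq T m = (real m)\<^sup>2 / (2 * real m + 1)"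
      using that unfolding alpha_seq_sums(2)[OF r that] True
      by (simp add: field_simps power2_eq_square)
    moreover have "real m * 1 \<le> real m * real m"
      using that by (intro mult_left_mono) auto
    ultimately show "real m \<le> 3 * alpha_seq T m" "alpha_seq T m \<le> real m"
      by (simp_all add: pos_le_divide_eq pos_divide_le_eq power2_eq_square algebra_simps)
  qed
  have sqrt_bounds: "sqrt (real m) \<le> 2 * sqrt (alpha_seq T m)" "sqrt (alpha_seq T m) \<le> sqrt (real m)"
    if "1 \<le> m" for m
  proof -
    \<comment> \<open>The factor 3 is weakened to 4, whose root is 2.\<close>
    have "sqrt (real m) \<le> sqrt (4 * alpha_seq T m)"
      using bounds[OF that] alpha_seq_pos[OF r that] by (intro real_sqrt_le_mono) simp
    then show "sqrt (real m) \<le> 2 * sqrt (alpha_seq T m)"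
      by (simp add: real_sqrt_mult)
    show "sqrt (alpha_seq T m) \<le> sqrt (real m)"
      using bounds[OF that] by simp
  qed
  show thesis
  proof (rule that[of 4]; (intro allI impI)?)
    fix m :: nat
    assume m: "1 \<le> m"
    then have "1 \<le> m\<^sup>2"
      by simp
    from sqrt_bounds[OF this] bounds[OF m] m
    show "\<exists>k\<ge>1. alpha_seq T m \<le> 4 * sqrt (alpha_seq T k) \<and>
        sqrt (alpha_seq T k) \<le> 4 * alpha_seq T m"
      by (intro exI[of _ "m\<^sup>2"]) auto
  next
    fix m :: nat
    assume m: "1 \<le> m"
    \<comment> \<open>Since \<open>sqrt m \<ge> 1\<close>, rounding up at most doubles it; with the
      factor 2 in \<open>sqrt_bounds\<close> this yields the constant 4.\<close>
    define k where "k = nat \<lceil>sqrt (real m)\<rceil>"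
    have "1 \<le> sqrt (real m)"
      using m by simp
    then have k: "sqrt (real m) \<le> real k" "real k \<le> 2 * sqrt (real m)" "1 \<le> k"
      unfolding k_def by linarith+
    have "sqrt (alpha_seq T m) \<le> 4 * alpha_seq T k" "alpha_seq T k \<le> 4 * sqrt (alpha_seq T m)"
      using k bounds[OF k(3)] sqrt_bounds[OF m] by linarith+
    with k(3) show "\<exists>k\<ge>1. sqrt (alpha_seq T m) \<le> 4 * alpha_seq T k \<and>
        alpha_seq T k \<le> 4 * sqrt (alpha_seq T m)"
      by blast
  qed simp
next
  case False
  define r where "r = spectral_radius T"
  have r1: "1 < r"
    using False assms by (simp add: r_def)
  \<comment> \<open>\<open>lo\<close> is the weight at \<open>m = 1\<close> and \<open>hi\<close>
    its limit for large \<open>m\<close>. All weights lie between them, so \<open>k = m\<close>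
    serves in both comparisons.\<close>
  define lo where "lo = 1 / ((1 + r)\<^sup>2 - 1)"
  define hi where "hi = 1 / (r\<^sup>2 - 1)"
  have "1 < r\<^sup>2"
    using r1 by (simp add: one_less_power)
  define K where "K = 1 + sqrt hi + 1 / sqrt lo"
  have r_sq: "r\<^sup>2 \<le> w\<^sup>2" if "r \<le> w" for w
    using that r1 by (intro power_mono) auto
  have lo: "0 < lo"
    using r_sq[of "1 + r"] \<open>1 < r\<^sup>2\<close> by (simp add: lo_def)
  have hi: "0 < hi"
    using \<open>1 < r\<^sup>2\<close> by (simp add: hi_def)
  have K: "1 \<le> K" "sqrt hi \<le> K" "1 / sqrt lo \<le> K"
    using lo hi by (simp_all add: K_def)
  have comparable: "alpha_seq T m \<le> K * sqrt (alpha_seq T m)"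
    "sqrt (alpha_seq T m) \<le> K * alpha_seq T m" if m: "1 \<le> m" for m
  proof -
    define w where "w = 1 / real m + r"
    define c where "c = alpha_seq T m"
    have w: "r \<le> w" "w \<le> 1 + r"
      using m by (simp_all add: w_def)
    have "w\<^sup>2 \<le> (1 + r)\<^sup>2"
      using w r1 by (intro power_mono) auto
    moreover have "c = 1 / (w\<^sup>2 - 1)"
      using alpha_seq_sums(2)[OF assms m] by (simp add: c_def w_def r_def)
    ultimately have c: "lo \<le> c" "c \<le> hi"
      using r_sq[OF w(1)] \<open>1 < r\<^sup>2\<close> by (simp_all add: lo_def hi_def frac_le)
    have pos: "0 < sqrt c"
      using c lo by simp
    have sq: "c = sqrt c * sqrt c"
      using pos by simp
    have "sqrt c \<le> K"
      using real_sqrt_le_mono[OF c(2)] K(2) by (rule order_trans)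
    then have "sqrt c * sqrt c \<le> K * sqrt c"
      by (rule mult_right_mono[OF _ less_imp_le[OF pos]])
    then show "alpha_seq T m \<le> K * sqrt (alpha_seq T m)"
      using sq by (simp add: c_def)
    have "1 \<le> (1 / sqrt lo) * sqrt c"
      using c lo by simp
    also have "\<dots> \<le> K * sqrt c"
      by (rule mult_right_mono[OF K(3) less_imp_le[OF pos]])
    finally have "1 * sqrt c \<le> (K * sqrt c) * sqrt c"
      by (rule mult_right_mono[OF _ less_imp_le[OF pos]])
    then show "sqrt (alpha_seq T m) \<le> K * alpha_seq T m"
      using sq by (simp add: c_def mult.assoc)
  qed
  show thesis
    using comparable by (intro that[OF K(1)]) blast+
qed

section \<open>Membership in the two algebras\<close>

lemma spectral_radius_algebra_iff:
  assumes "S \<in> bounded_ops" "T \<in> bounded_ops" "quasi_isometry T" "1 \<le> spectral_radius T"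
  shows "S \<in> spectral_radius_algebra T \<longleftrightarrow>
    (\<exists>M>0. \<forall>m\<ge>1. \<forall>x. norm (S x) + norm (T (S x)) * sqrt (alpha_seq T m)
      \<le> M * (norm x + norm (T x) * sqrt (alpha_seq T m)))"
proof -
  let ?h = "\<lambda>m x. norm x + norm (T x) * sqrt (alpha_seq T m)"
  \<comment> \<open>\<open>norm (Rseq T m x)\<close> is the Euclidean length of the pair whose
    entries add up to \<open>?h m x\<close>; length and sum agree up to a factor 2.\<close>
  have norms: "norm (Rseq T m x) \<le> ?h m x" "?h m x \<le> 2 * norm (Rseq T m x)" if "1 \<le> m" for m x
  proof -
    note sq = norm_Rseq[OF assms(2-4) that, of x]
    have pos: "0 < alpha_seq T m"
      by (rule alpha_seq_pos[OF assms(4) that])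
    have sq': "(norm (T x) * sqrt (alpha_seq T m))\<^sup>2 = alpha_seq T m * (norm (T x))\<^sup>2"
      using pos by (simp add: power_mult_distrib)
    have "(norm (Rseq T m x))\<^sup>2 \<le> (?h m x)\<^sup>2"
      using pos unfolding sq power2_sum sq' by simp
    then show "norm (Rseq T m x) \<le> ?h m x"
      by (rule power2_le_imp_le) (use pos in simp)
    have "norm x \<le> norm (Rseq T m x)"
      by (rule power2_le_imp_le) (use pos in \<open>simp_all add: sq\<close>)
    moreover have "norm (T x) * sqrt (alpha_seq T m) \<le> norm (Rseq T m x)"
      by (rule power2_le_imp_le) (simp_all only: sq sq' norm_ge_zero, simp)
    ultimately show "?h m x \<le> 2 * norm (Rseq T m x)"
      by simp
  qed
  have "S \<in> spectral_radius_algebra T \<longleftrightarrow>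
      (\<exists>M>0. \<forall>m\<in>{1..}. \<forall>x. norm (Rseq T m (S x)) \<le> M * norm (Rseq T m x))"
  proof -
    have "\<forall>m\<in>{1..}. \<exists>B. is_op_inverse (Rseq T m) B"
      using Rseq_invertible[OF assms(2-4)] by simp
    then show ?thesis
      using assms(1)
      by (simp only: spectral_radius_algebra_def mem_Collect_eq bdd_above_similar_iff simp_thms)
  qed
  also have "\<dots> \<longleftrightarrow> (\<exists>M>0. \<forall>m\<ge>1. \<forall>x. ?h m (S x) \<le> M * ?h m x)"
  proof
    assume "\<exists>M>0. \<forall>m\<in>{1..}. \<forall>x. norm (Rseq T m (S x)) \<le> M * norm (Rseq T m x)"
    then obtain M where "M > 0"
      and M: "\<And>m x. 1 \<le> m \<Longrightarrow> norm (Rseq T m (S x)) \<le> M * norm (Rseq T m x)"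
      by auto
    have "?h m (S x) \<le> (2 * M) * ?h m x" if "1 \<le> m" for m x
    proof -
      have "M * norm (Rseq T m x) \<le> M * ?h m x"
        using \<open>M > 0\<close> norms(1)[OF that] by (intro mult_left_mono) auto
      then show ?thesis
        using norms(2)[OF that, of "S x"] M[OF that, of x] by linarith
    qed
    moreover have "2 * M > 0"
      using \<open>M > 0\<close> by simp
    ultimately show "\<exists>M>0. \<forall>m\<ge>1. \<forall>x. ?h m (S x) \<le> M * ?h m x"
      by blast
  next
    assume "\<exists>M>0. \<forall>m\<ge>1. \<forall>x. ?h m (S x) \<le> M * ?h m x"
    then obtain M where "M > 0" and M: "\<And>m x. 1 \<le> m \<Longrightarrow> ?h m (S x) \<le> M * ?h m x"
      by blast
    have "norm (Rseq T m (S x)) \<le> (2 * M) * norm (Rseq T m x)" if "1 \<le> m" for m x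
    proof -
      have "M * ?h m x \<le> M * (2 * norm (Rseq T m x))"
        using \<open>M > 0\<close> norms(2)[OF that] by (intro mult_left_mono) auto
      then show ?thesis
        using norms(1)[OF that, of "S x"] M[OF that, of x] by linarith
    qed
    moreover have "2 * M > 0"
      using \<open>M > 0\<close> by simp
    ultimately show "\<exists>M>0. \<forall>m\<in>{1..}. \<forall>x. norm (Rseq T m (S x)) \<le> M * norm (Rseq T m x)"
      by (meson atLeast_iff)
  qed
  finally show ?thesis .
qed

lemma spectral_radius_algebra_less_1:
  fixes T :: "'a::complex_hilbert \<Rightarrow>\<^sub>L 'a"
  assumes "T \<in> bounded_ops" "quasi_isometry T" "spectral_radius T < 1"
  shows "spectral_radius_algebra T = bounded_ops"
proof -
  have T: "T = 0"
    by (rule quasi_isometry_spectral_radius_less_1[OF assms])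
  have TT: "hadjoint T o\<^sub>L T = 0"
    by (rule blinfun_eqI) (simp add: T blinfun.bilinear_simps)
  have R: "Rseq T m = op_sqrt (id_blinfun + 0 *\<^sub>R (hadjoint T o\<^sub>L T))" for m
    by (rule Rseq_sums_op_sqrt[OF assms(2)]) (simp add: TT)
  have inv: "\<forall>m\<in>{1..}. \<exists>B. is_op_inverse (Rseq T m) B"
    unfolding R using op_sqrt_invertible[OF assms(1) order_refl] by blast
  have "(norm (Rseq T m x))\<^sup>2 = (norm x)\<^sup>2" for m x
    using norm_op_sqrt[OF assms(1) order_refl, of x] unfolding R by simp
  then have norm_R: "norm (Rseq T m x) = norm x" for m x
    by simp
  have "bdd_above ((\<lambda>m. norm (Rseq T m o\<^sub>L S o\<^sub>L op_inverse (Rseq T m))) ` {1..})" for S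
  proof -
    \<comment> \<open>The added 1 keeps the constant positive when \<open>S = 0\<close>.\<close>
    have "norm (S x) \<le> (norm S + 1) * norm x" for x
      using norm_blinfun[of S x] by (simp add: distrib_right add_increasing2)
    moreover have "0 < norm S + 1"
      by (simp add: add_nonneg_pos)
    ultimately show ?thesis
      unfolding bdd_above_similar_iff[OF inv] norm_R by (intro exI[of _ "norm S + 1"]) simp
  qed
  then show ?thesis
    by (simp add: spectral_radius_algebra_def)
qed

text \<open>The case \<open>n = 1\<close> is majorization itself. All \<open>n \<ge> 1\<close>
  reduce to it because the norms of the powers are constant, and \<open>n = 0\<close> costs only
  \<open>norm S\<close>.\<close>

lemma deddens_algebra_iff:
  assumes "S \<in> bounded_ops" "T \<in> bounded_ops" "quasi_isometry T"
  shows "S \<in> deddens_algebra T \<longleftrightarrow> majorizes T (T o\<^sub>L S)"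
proof
  assume "S \<in> deddens_algebra T"
  then obtain M where "M > 0" "\<And>n x. norm (op_power T n (S x)) \<le> M * norm (op_power T n x)"
    by (auto simp: deddens_algebra_def)
  from this(1) this(2)[of "Suc 0"] show "majorizes T (T o\<^sub>L S)"
    by (auto simp: majorizes_def op_power_Suc)
next
  assume "majorizes T (T o\<^sub>L S)"
  then obtain M where "M > 0" and M: "\<And>x. norm (T (S x)) \<le> M * norm (T x)"
    by (auto simp: majorizes_def)
  have "norm (op_power T n (S x)) \<le> (M + norm S) * norm (op_power T n x)" for n x
  proof (cases n)
    case 0
    have "norm (S x) \<le> norm S * norm x"
      by (rule norm_blinfun)
    also have "\<dots> \<le> (M + norm S) * norm x"
      using \<open>M > 0\<close> by (intro mult_right_mono) auto
    finally show ?thesis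
      using 0 by simp
  next
    case (Suc k)
    have "norm (T (S x)) \<le> (M + norm S) * norm (T x)"
      using M[of x] by (simp add: distrib_right add_increasing2)
    then show ?thesis
      by (simp only: Suc quasi_isometry_norm_power[OF assms(2,3)])
  qed
  moreover have "0 < M + norm S"
    using \<open>M > 0\<close> by (simp add: add_pos_nonneg)
  ultimately show "S \<in> deddens_algebra T"
    using assms(1) by (auto simp: deddens_algebra_def)
qed

theorem theorem2p7:
  fixes S T :: "'a::complex_hilbert \<Rightarrow>\<^sub>L 'a"
  assumes "S \<in> bounded_ops" and "T \<in> bounded_ops" and "quasi_isometry T"
  shows "(S \<in> deddens_algebra T \<longleftrightarrow> majorizes T (T o\<^sub>L S))
    \<and> (spectral_radius T < 1 \<longrightarrow> spectral_radius_algebra T = bounded_ops)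
    \<and> (spectral_radius T \<ge> 1 \<longrightarrow>
        (S \<in> spectral_radius_algebra T \<longleftrightarrow>
          (\<exists>M>0. \<forall>m\<ge>1. \<forall>x.
             norm (S x) + norm (T (S x)) * alpha_seq T m
               \<le> M * (norm x + norm (T x) * alpha_seq T m))))"
proof (intro conjI impI)
  show "S \<in> deddens_algebra T \<longleftrightarrow> majorizes T (T o\<^sub>L S)"
    by (rule deddens_algebra_iff[OF assms])
next
  assume "spectral_radius T < 1"
  then show "spectral_radius_algebra T = bounded_ops"
    by (rule spectral_radius_algebra_less_1[OF assms(2,3)])
next
  assume r: "1 \<le> spectral_radius T"
  obtain K where K: "1 \<le> K"
    and alpha: "\<forall>m\<ge>1. \<exists>k\<ge>1. alpha_seq T m \<le> K * sqrt (alpha_seq T k) \<and>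
      sqrt (alpha_seq T k) \<le> K * alpha_seq T m"
    and sqrt_alpha: "\<forall>m\<ge>1. \<exists>k\<ge>1. sqrt (alpha_seq T m) \<le> K * alpha_seq T k \<and>
      alpha_seq T k \<le> K * sqrt (alpha_seq T m)"
    by (rule alpha_seq_comparable_sqrt[OF r])
  \<comment> \<open>The algebra is first described with the weight
    \<open>sqrt (alpha_seq T m)\<close>; \<open>alpha\<close> carries that bound to the weight
    \<open>alpha_seq T m\<close>, and \<open>sqrt_alpha\<close> carries it back.\<close>
  show "S \<in> spectral_radius_algebra T \<longleftrightarrow>
      (\<exists>M>0. \<forall>m\<ge>1. \<forall>x. norm (S x) + norm (T (S x)) * alpha_seq T m
        \<le> M * (norm x + norm (T x) * alpha_seq T m))"
    unfolding spectral_radius_algebra_iff[OF assms r]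
    using weighted_bound_reindex[OF norm_ge_zero norm_ge_zero norm_ge_zero norm_ge_zero K alpha]
      weighted_bound_reindex[OF norm_ge_zero norm_ge_zero norm_ge_zero norm_ge_zero K sqrt_alpha]
    by (rule iffI)
qed

end
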